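(* The set $\mathfrak{A}$ is dense in $\mathcal{C}\times\mathcal{C}$. That is, the pairs $(f,g)\in\mathcal{C}\times\mathcal{C}$ with the following property form a dense subset: writing $d=\alpha_{f-g}$, whenever $x_0$ satisfies $|f-g|=|f-g+d|_0=f(x_0)-g(x_0)+d$, one has $f(\tau_i(x_0))-g(\tau_i(x_0))+d\neq f(x_0)-g(x_0)+d$ for $i=1,2$.
   Context: $S^1=\mathbb{R}/\mathbb{Z}$, $T(x)=2x\pmod 1$ is the doubling map, with inverse branches $\tau_i(x)=\frac12(x+i-1)$, $i=1,2$ (for $x\in[0,1]$). $C^0$ is the space of continuous functions $S^1\to\mathbb{R}$ with $|f|_0=\sup|f|$, and $\mathcal{C}=C^0/\mathbb{R}$ is its quotient by the constants; in each class the representative with supremum $0$ is chosen. $\mathcal{C}$ carries the quotient norm $|f|=\inf_{\alpha\in\mathbb{R}}|f+\alpha|_0$. The infimum is attained at $\alpha_f:=-\frac{\max f+\min f}{2}$. The product $\mathcal{C}\times\mathcal{C}$ carries the distance $d((f,g),(f',g'))=\max(|f-f'|,|g-g'|)$. $\mathfrak{A}\subset\mathcal{C}\times\mathcal{C}$ is the set of pairs $(f_0,g_0)$ such that, for every $r$ with $|f_0-g_0|=|(f_0-g_0)+\alpha_{f_0-g_0}|_0=(f_0-g_0)(r)+\alpha_{f_0-g_0}$, one has $(f_0-g_0)(r)\neq(f_0-g_0)(\tau_1(r))$ and $(f_0-g_0)(r)\neq(f_0-g_0)(\tau_2(r))$. *)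

theory Defs
  imports "HOL-Analysis.Analysis"
begin

section \<open>The circle and the inverse branches of the doubling map\<close>

quotient_type circle = real / "\<lambda>x y. x - y \<in> \<int>" morphisms rep_circle circle_of
proof (rule equivpI)
  show "reflp (\<lambda>x y::real. x - y \<in> \<int>)"
    by (simp add: reflp_def)
  show "symp (\<lambda>x y::real. x - y \<in> \<int>)"
  proof (rule sympI)
    fix x y :: real
    assume "x - y \<in> \<int>"
    then have "- (x - y) \<in> \<int>"
      by (rule Ints_minus)
    then show "y - x \<in> \<int>"
      by simp
  qed
  show "transp (\<lambda>x y::real. x - y \<in> \<int>)"
  proof (rule transpI)
    fix x y z :: real
    assume "x - y \<in> \<int>" "y - z \<in> \<int>"
    then have "(x - y) + (y - z) \<in> \<int>"
      by (rule Ints_add)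
    then show "x - z \<in> \<int>"
      by simp
  qed
qed

instantiation circle :: topological_space
begin

definition open_circle :: "circle set \<Rightarrow> bool"
  where "open_circle U \<longleftrightarrow> open (circle_of -` U)"

instance
  by standard (auto simp: open_circle_def vimage_Union intro: open_Int)

end

lemma circle_of_eq_iff: "circle_of x = circle_of y \<longleftrightarrow> x - y \<in> \<int>"
  by (simp add: circle.abs_eq_iff)

lemma circle_of_surj: "\<exists>x. c = circle_of x"
  by (induct c rule: circle.abs_induct) blast

lemma continuous_on_circle_of: "continuous_on A circle_of"
  by (rule continuous_on_subset[of UNIV])
     (auto simp: continuous_on_open_vimage open_circle_def)

lemma circle_of_image_unit_interval: "circle_of ` {0..1} = UNIV"
proof (rule UNIV_eq_I[symmetric])
  fix c
  obtain x where c: "c = circle_of x"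
    using circle_of_surj by blast
  have "x - frac x \<in> \<int>"
    by (simp add: frac_def)
  then have "c = circle_of (frac x)"
    by (simp add: c circle_of_eq_iff)
  moreover have "frac x \<in> {0..1}"
    using frac_ge_0[of x] frac_lt_1[of x] by simp
  ultimately show "c \<in> circle_of ` {0..1}"
    by (rule image_eqI)
qed

lemma compact_circle: "compact (UNIV :: circle set)"
  using compact_continuous_image[OF continuous_on_circle_of compact_Icc[of 0 1]]
  by (simp add: circle_of_image_unit_interval)

lift_definition doubling :: "circle \<Rightarrow> circle" is "\<lambda>x::real. 2 * x"
proof -
  fix x y :: real
  assume "x - y \<in> \<int>"
  then have "2 * (x - y) \<in> \<int>"
    by (intro Ints_mult) simp_all
  then show "2 * x - 2 * y \<in> \<int>"
    by (simp add: algebra_simps)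
qed

definition tau :: "nat \<Rightarrow> real \<Rightarrow> real"
  where "tau i x = (x + real i - 1) / 2"

text \<open>
  On the circle the two branches are only well defined as an unordered pair at the point
  \<open>circle_of 0 = circle_of 1\<close>, where each of them depends on the choice of the representative;
  the pair is the full preimage under the doubling map in either case.
\<close>

lemma doubling_preimage:
  "{c. doubling c = circle_of x} = {circle_of (tau 1 x), circle_of (tau 2 x)}"
proof (intro set_eqI iffI)
  fix c assume "c \<in> {c. doubling c = circle_of x}"
  moreover obtain y where c: "c = circle_of y"
    using circle_of_surj by blast
  ultimately have "2 * y - x \<in> \<int>"
    by (simp add: doubling.abs_eq circle_of_eq_iff)
  then obtain k where k: "2 * y - x = of_int k"
    by (rule Ints_cases)
  show "c \<in> {circle_of (tau 1 x), circle_of (tau 2 x)}"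
  proof (cases "even k")
    case True
    then obtain m where "k = 2 * m" ..
    then have "y - tau 1 x = of_int m"
      using k by (simp add: tau_def field_simps)
    then have "y - tau 1 x \<in> \<int>"
      by (metis Ints_of_int)
    then show ?thesis
      by (simp add: c circle_of_eq_iff)
  next
    case False
    then obtain m where "k = 2 * m + 1" ..
    then have "y - tau 2 x = of_int m"
      using k by (simp add: tau_def field_simps)
    then have "y - tau 2 x \<in> \<int>"
      by (metis Ints_of_int)
    then show ?thesis
      by (simp add: c circle_of_eq_iff)
  qed
next
  fix c assume "c \<in> {circle_of (tau 1 x), circle_of (tau 2 x)}"
  then show "c \<in> {c. doubling c = circle_of x}"
    by (auto simp: tau_def doubling.abs_eq circle_of_eq_iff add_divide_distrib)
qed


section \<open>Continuous functions on the circle modulo constants\<close>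

text \<open>
  As the circle is compact, the type \<open>circle \<Rightarrow>\<^sub>C real\<close> of bounded continuous functions
  consists of all continuous functions; its norm is the supremum norm.
\<close>

lemma bcontfun_circle_iff:
  fixes f :: "circle \<Rightarrow> real"
  shows "f \<in> bcontfun \<longleftrightarrow> continuous_on UNIV f"
  using compact_circle compact_continuous_image compact_imp_bounded
  by (auto simp: bcontfun_def)

lemma norm_circle_fun:
  fixes f :: "circle \<Rightarrow>\<^sub>C real"
  shows "norm f = (SUP x. \<bar>f x\<bar>)"
  by (simp add: norm_bcontfun_def dist_bcontfun.rep_eq)

lemma circle_fun_attains:
  fixes f :: "circle \<Rightarrow>\<^sub>C real"
  shows "\<exists>a. f a = (SUP x. f x)" "\<exists>b. f b = (INF x. f x)"
proof -
  obtain a where "\<forall>y. f y \<le> f a"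
    using continuous_attains_sup[OF compact_circle, of "apply_bcontfun f"] by auto
  then have "(SUP x. f x) = f a"
    by (intro cSup_eq_maximum) auto
  then show "\<exists>a. f a = (SUP x. f x)"
    by metis
  obtain b where "\<forall>y. f b \<le> f y"
    using continuous_attains_inf[OF compact_circle, of "apply_bcontfun f"] by auto
  then have "(INF x. f x) = f b"
    by (intro cInf_eq_minimum) auto
  then show "\<exists>b. f b = (INF x. f x)"
    by metis
qed

lemma circle_fun_le_SUP: "f y \<le> (SUP x. f x)" for f :: "circle \<Rightarrow>\<^sub>C real"
  by (rule cSUP_upper) (auto intro: bounded_imp_bdd_above)

lemma circle_fun_INF_le: "(INF x. f x) \<le> f y" for f :: "circle \<Rightarrow>\<^sub>C real"
  by (rule cINF_lower) (auto intro: bounded_imp_bdd_below)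

lemma const_bcontfun_add: "const_bcontfun (a + b) = const_bcontfun a + const_bcontfun b"
  for a b :: real
  by (rule bcontfun_eqI) simp

lemma const_bcontfun_minus: "const_bcontfun (- a) = - const_bcontfun a"
  for a :: real
  by (rule bcontfun_eqI) simp

lemma const_bcontfun_diff: "const_bcontfun (a - b) = const_bcontfun a - const_bcontfun b"
  for a b :: real
  by (rule bcontfun_eqI) simp

lemma const_bcontfun_scaleR: "const_bcontfun (r * a) = r *\<^sub>R const_bcontfun a"
  for a r :: real
  by (rule bcontfun_eqI) simp

quotient_type cont_mod_const = "circle \<Rightarrow>\<^sub>C real" / "\<lambda>f g. \<exists>c. f - g = const_bcontfun c"
  morphisms rep_cont_mod_const cls
proof (rule equivpI)
  let ?R = "\<lambda>f g :: circle \<Rightarrow>\<^sub>C real. \<exists>c. f - g = const_bcontfun c"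
  show "reflp ?R"
    by (auto intro!: reflpI exI[of _ 0])
  show "symp ?R"
  proof (rule sympI)
    fix f g :: "circle \<Rightarrow>\<^sub>C real"
    assume "\<exists>c. f - g = const_bcontfun c"
    then obtain c where "f - g = const_bcontfun c" ..
    then have "g - f = const_bcontfun (- c)"
      by (metis const_bcontfun_minus minus_diff_eq)
    then show "\<exists>c. g - f = const_bcontfun c" ..
  qed
  show "transp ?R"
  proof (rule transpI)
    fix f g h :: "circle \<Rightarrow>\<^sub>C real"
    assume "\<exists>c. f - g = const_bcontfun c" "\<exists>c. g - h = const_bcontfun c"
    then obtain a b where "f - g = const_bcontfun a" "g - h = const_bcontfun b"
      by blast
    then have "f - h = const_bcontfun (a + b)"
      by (simp add: const_bcontfun_add algebra_simps)
    then show "\<exists>c. f - h = const_bcontfun c" ..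
  qed
qed

lemma cls_surj: "\<exists>f. F = cls f"
  by (induct F rule: cont_mod_const.abs_induct) blast

lemma cls_eq_iff: "cls f = cls g \<longleftrightarrow> (\<exists>c. f = g + const_bcontfun c)"
  by (simp add: cont_mod_const.abs_eq_iff algebra_simps)

instantiation cont_mod_const :: real_vector
begin

lift_definition zero_cont_mod_const :: cont_mod_const is 0 .

lift_definition plus_cont_mod_const :: "cont_mod_const \<Rightarrow> cont_mod_const \<Rightarrow> cont_mod_const"
  is "(+)"
  by (metis add_diff_add const_bcontfun_add)

lift_definition uminus_cont_mod_const :: "cont_mod_const \<Rightarrow> cont_mod_const" is uminus
  by (metis const_bcontfun_minus minus_diff_minus)

lift_definition minus_cont_mod_const :: "cont_mod_const \<Rightarrow> cont_mod_const \<Rightarrow> cont_mod_const"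
  is "(-)"
proof -
  fix f f' g g' :: "circle \<Rightarrow>\<^sub>C real"
  assume "\<exists>c. f - f' = const_bcontfun c" "\<exists>c. g - g' = const_bcontfun c"
  then obtain a b where "f - f' = const_bcontfun a" "g - g' = const_bcontfun b"
    by blast
  then have "f - g - (f' - g') = const_bcontfun (a - b)"
    by (simp add: const_bcontfun_diff algebra_simps)
  then show "\<exists>c. f - g - (f' - g') = const_bcontfun c" ..
qed

lift_definition scaleR_cont_mod_const :: "real \<Rightarrow> cont_mod_const \<Rightarrow> cont_mod_const"
  is scaleR
  by (metis const_bcontfun_scaleR scaleR_right_diff_distrib)

instance
  by standard
    ((transfer; rule exI[of _ 0]; simp add: algebra_simps))+

end

lemma INF_norm_le: "(INF a. norm (f + const_bcontfun a)) \<le> norm (f + const_bcontfun b)"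
  for f :: "circle \<Rightarrow>\<^sub>C real"
  by (rule cINF_lower) (auto intro: bdd_belowI[of _ 0])

lemma INF_norm_ge: "r \<le> (INF a. norm (f + const_bcontfun a))"
  if "\<And>a. r \<le> norm (f + const_bcontfun a)" for f :: "circle \<Rightarrow>\<^sub>C real"
  by (rule cINF_greatest) (use that in auto)

text \<open>By \<open>circle_fun_attains\<close> the supremum and infimum are the maximum and minimum.\<close>

definition alpha :: "(circle \<Rightarrow>\<^sub>C real) \<Rightarrow> real"
  where "alpha f = - ((SUP x. f x) + (INF x. f x)) / 2"

lemma INF_norm_eq_alpha:
  "(INF a. norm (f + const_bcontfun a)) = norm (f + const_bcontfun (alpha f))"
proof (rule antisym[OF INF_norm_le INF_norm_ge])
  fix a
  obtain p q where p: "f p = (SUP x. f x)" and q: "f q = (INF x. f x)"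
    using circle_fun_attains[of f] by metis
  have "f p + a \<le> norm (f + const_bcontfun a)" "- (f q + a) \<le> norm (f + const_bcontfun a)"
    using norm_bounded[of "f + const_bcontfun a" p] norm_bounded[of "f + const_bcontfun a" q]
    by (simp_all add: abs_le_iff)
  moreover have "norm (f + const_bcontfun (alpha f)) \<le> (f p - f q) / 2"
  proof (rule norm_bound)
    fix x
    show "norm ((f + const_bcontfun (alpha f)) x) \<le> (f p - f q) / 2"
      using circle_fun_le_SUP[of f x] circle_fun_INF_le[of f x]
      by (simp add: alpha_def p q abs_le_iff field_simps)
  qed
  ultimately show "norm (f + const_bcontfun (alpha f)) \<le> norm (f + const_bcontfun a)"
    by (simp add: field_simps)
qed

instantiation cont_mod_const :: real_normed_vector
begin

lift_definition norm_cont_mod_const :: "cont_mod_const \<Rightarrow> real"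
  is "\<lambda>f. INF a. norm (f + const_bcontfun a)"
proof -
  have le: "(INF a. norm (f + const_bcontfun a)) \<le> (INF a. norm (g + const_bcontfun a))"
    if "f - g = const_bcontfun c" for f g :: "circle \<Rightarrow>\<^sub>C real" and c
  proof (rule INF_norm_ge)
    fix a
    have "g + const_bcontfun a = f + const_bcontfun (a - c)"
      using that by (simp add: const_bcontfun_diff algebra_simps)
    then show "(INF a. norm (f + const_bcontfun a)) \<le> norm (g + const_bcontfun a)"
      by (metis INF_norm_le)
  qed
  fix f g :: "circle \<Rightarrow>\<^sub>C real"
  assume "\<exists>c. f - g = const_bcontfun c"
  then obtain c where "f - g = const_bcontfun c" "g - f = const_bcontfun (- c)"
    by (metis const_bcontfun_minus minus_diff_eq)
  then show "(INF a. norm (f + const_bcontfun a)) = (INF a. norm (g + const_bcontfun a))"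
    by (intro antisym le)
qed

definition dist_cont_mod_const :: "cont_mod_const \<Rightarrow> cont_mod_const \<Rightarrow> real"
  where "dist_cont_mod_const F G = norm (F - G)"

definition sgn_cont_mod_const :: "cont_mod_const \<Rightarrow> cont_mod_const"
  where "sgn_cont_mod_const F = F /\<^sub>R norm F"

definition uniformity_cont_mod_const :: "(cont_mod_const \<times> cont_mod_const) filter"
  where "uniformity_cont_mod_const = (INF e\<in>{0<..}. principal {(F, G). dist F G < e})"

definition open_cont_mod_const :: "cont_mod_const set \<Rightarrow> bool"
  where "open_cont_mod_const S \<longleftrightarrow>
    (\<forall>F\<in>S. \<forall>\<^sub>F (F', G) in uniformity. F' = F \<longrightarrow> G \<in> S)"

instance
proof
  fix F G :: cont_mod_const and r :: real
  show norm0: "norm F = 0 \<longleftrightarrow> F = 0" for F :: cont_mod_const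
  proof transfer
    fix f :: "circle \<Rightarrow>\<^sub>C real"
    have "(INF a. norm (f + const_bcontfun a)) = 0 \<longleftrightarrow> f + const_bcontfun (alpha f) = 0"
      by (simp add: INF_norm_eq_alpha)
    also have "\<dots> \<longleftrightarrow> (\<exists>c. f - 0 = const_bcontfun c)"
    proof
      assume "f + const_bcontfun (alpha f) = 0"
      then have "f - 0 = const_bcontfun (- alpha f)"
        by (simp add: const_bcontfun_minus eq_neg_iff_add_eq_0)
      then show "\<exists>c. f - 0 = const_bcontfun c" ..
    next
      assume "\<exists>c. f - 0 = const_bcontfun c"
      then obtain c where "f = const_bcontfun c"
        by auto
      then show "f + const_bcontfun (alpha f) = 0"
        by (intro bcontfun_eqI) (simp add: alpha_def)
    qed
    finally show "(INF a. norm (f + const_bcontfun a)) = 0 \<longleftrightarrow> (\<exists>c. f - 0 = const_bcontfun c)" .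
  qed
  show "norm (F + G) \<le> norm F + norm G"
  proof transfer
    fix f g :: "circle \<Rightarrow>\<^sub>C real"
    have "f + g + const_bcontfun (alpha f + alpha g) =
        (f + const_bcontfun (alpha f)) + (g + const_bcontfun (alpha g))"
      by (simp add: const_bcontfun_add)
    then show "(INF a. norm (f + g + const_bcontfun a)) \<le>
        (INF a. norm (f + const_bcontfun a)) + (INF a. norm (g + const_bcontfun a))"
      unfolding INF_norm_eq_alpha[of f] INF_norm_eq_alpha[of g]
      by (metis INF_norm_le norm_triangle_ineq order_trans)
  qed
  have le: "norm (r *\<^sub>R F) \<le> \<bar>r\<bar> * norm F" for r and F :: cont_mod_const
  proof transfer
    fix r and f :: "circle \<Rightarrow>\<^sub>C real"
    have "r *\<^sub>R f + const_bcontfun (r * alpha f) = r *\<^sub>R (f + const_bcontfun (alpha f))"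
      by (simp add: const_bcontfun_scaleR scaleR_right_distrib)
    then show "(INF a. norm (r *\<^sub>R f + const_bcontfun a)) \<le>
        \<bar>r\<bar> * (INF a. norm (f + const_bcontfun a))"
      unfolding INF_norm_eq_alpha[of f] by (metis INF_norm_le norm_scaleR)
  qed
  show "norm (r *\<^sub>R F) = \<bar>r\<bar> * norm F"
  proof (cases "r = 0")
    case True
    then show ?thesis
      using norm0 by simp
  next
    case False
    have "\<bar>r\<bar> * norm F = \<bar>r\<bar> * norm (inverse r *\<^sub>R (r *\<^sub>R F))"
      using False by simp
    also have "\<dots> \<le> \<bar>r\<bar> * (\<bar>inverse r\<bar> * norm (r *\<^sub>R F))"
      by (intro mult_left_mono le) simp
    also have "\<dots> = norm (r *\<^sub>R F)"
      using False by (simp add: abs_mult[symmetric] mult.assoc[symmetric])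
    finally show ?thesis
      using le[of r F] by simp
  qed
qed (auto simp: dist_cont_mod_const_def sgn_cont_mod_const_def
      uniformity_cont_mod_const_def open_cont_mod_const_def)

end

lemma norm_cls_eq_alpha: "norm (cls f) = norm (f + const_bcontfun (alpha f))"
  by (simp add: norm_cont_mod_const.abs_eq INF_norm_eq_alpha)

text \<open>The representative with supremum 0; existence and uniqueness is \<open>ex1_sup0_rep\<close> below.\<close>

definition sup0_rep :: "cont_mod_const \<Rightarrow> (circle \<Rightarrow>\<^sub>C real)"
  where "sup0_rep F = (THE f. cls f = F \<and> (SUP x. f x) = 0)"

lemma SUP_add_const: "(SUP x. (f + const_bcontfun c) x) = (SUP x. f x) + c"
  for f :: "circle \<Rightarrow>\<^sub>C real"
proof -
  obtain a where "f a = (SUP x. f x)"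
    using circle_fun_attains by metis
  then show ?thesis
    using circle_fun_le_SUP[of f] by (intro cSup_eq_maximum) (auto intro!: image_eqI[of _ _ a])
qed

lemma ex1_sup0_rep: "\<exists>!f. cls f = F \<and> (SUP x. f x) = 0"
proof -
  obtain f where F: "F = cls f"
    using cls_surj by blast
  show ?thesis
  proof (rule ex1I[of _ "f + const_bcontfun (- (SUP x. f x))"])
    show "cls (f + const_bcontfun (- (SUP x. f x))) = F \<and>
        (SUP x. (f + const_bcontfun (- (SUP x. f x))) x) = 0"
      unfolding SUP_add_const F cls_eq_iff by auto
  next
    fix g assume "cls g = F \<and> (SUP x. g x) = 0"
    then obtain c where g: "g = f + const_bcontfun c" and "(SUP x. g x) = 0"
      unfolding F cls_eq_iff by blast
    then have "c = - (SUP x. f x)"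
      using SUP_add_const[of f c] by simp
    then show "g = f + const_bcontfun (- (SUP x. f x))"
      using g by simp
  qed
qed

lemma cls_sup0_rep: "cls (sup0_rep F) = F"
  and SUP_sup0_rep: "(SUP x. sup0_rep F x) = 0"
  using theI'[OF ex1_sup0_rep[of F]] by (simp_all add: sup0_rep_def)


section \<open>Pairs of classes\<close>

definition max_dist ::
    "cont_mod_const \<times> cont_mod_const \<Rightarrow> cont_mod_const \<times> cont_mod_const \<Rightarrow> real"
  where "max_dist = (\<lambda>(F, G) (F', G'). max (norm (F - F')) (norm (G - G')))"

interpretation max_dist: Metric_space UNIV max_dist
proof
  fix p q r :: "cont_mod_const \<times> cont_mod_const"
  show "max_dist p q = max_dist q p"
    by (simp add: max_dist_def case_prod_unfold norm_minus_commute)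
  show "max_dist p q = 0 \<longleftrightarrow> p = q"
    by (cases p; cases q) (auto simp: max_dist_def max_def)
  show "max_dist p r \<le> max_dist p q + max_dist q r"
    using norm_triangle_ineq[of "fst p - fst q" "fst q - fst r"]
      norm_triangle_ineq[of "snd p - snd q" "snd q - snd r"]
    by (auto simp: max_dist_def case_prod_unfold)
qed (auto simp: max_dist_def case_prod_unfold le_max_iff_disj)

text \<open>
  Points of the circle are parametrised by \<open>{0..1}\<close>, where the formula for the branches applies.
  The two parameters 0 and 1 of the same point give the same condition by
  \<open>doubling_preimage\<close>.
\<close>

definition frak_A :: "(cont_mod_const \<times> cont_mod_const) set"
  where "frak_A = {(F, G). let h = sup0_rep F - sup0_rep G in
    \<forall>r\<in>{0..1}.
      norm (F - G) = norm (h + const_bcontfun (alpha h)) \<and>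
      norm (h + const_bcontfun (alpha h)) = h (circle_of r) + alpha h \<longrightarrow>
        h (circle_of r) \<noteq> h (circle_of (tau 1 r)) \<and>
        h (circle_of r) \<noteq> h (circle_of (tau 2 r))}"

end

theory Submission
  imports Defs
begin

text \<open>
  Membership of a pair in \<open>frak_A\<close> depends only on the difference \<open>h\<close> of its representatives, and
  only on its class modulo constants. The points \<open>r\<close> that are tested are the maximum points of
  \<open>h\<close>: after the shift by \<open>alpha h\<close>, the norm is the largest value of \<open>\<bar>h\<bar>\<close>, so a point at
  which \<open>h\<close> itself reaches the norm is a maximum point. If \<open>h\<close> has a single maximum point \<open>p\<close>, the
  condition can fail only if \<open>p\<close> is its own preimage under the doubling map, that is, if \<open>p\<close> is the
  fixed point \<open>circle_of 0\<close>.

  Functions with a unique maximum point off the fixed point are dense. As the fixed point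
  has empty interior, continuity gives a point \<open>p\<close> other than the fixed point at which \<open>h\<close> is almost
  maximal. Cutting \<open>h\<close> off at the level \<open>h p\<close> and subtracting a small nonnegative function that
  vanishes exactly at \<open>p\<close> moves \<open>h\<close> very little and makes \<open>p\<close> the only maximum point
  (\<open>unique_max_dense\<close>). The difference is adjusted by changing only the first member of the pair.
\<close>

lemma continuous_on_circle_iff:
  fixes f :: "circle \<Rightarrow> 'a::topological_space"
  shows "continuous_on UNIV f \<longleftrightarrow> continuous_on UNIV (\<lambda>x. f (circle_of x))"
  by (simp add: continuous_on_open_vimage open_circle_def vimage_def)

lemma doubling_fixed_iff: "doubling c = c \<longleftrightarrow> c = circle_of 0"
proof -
  obtain x where "c = circle_of x"
    using circle_of_surj by blast
  then show ?thesis
    by (simp add: doubling.abs_eq circle_of_eq_iff)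
qed

text \<open>
  The witness is \<open>1 - cos (2 \<pi> (x - x0))\<close>, which is the squared chordal distance to the given
  point up to a constant factor.
\<close>

lemma circle_fun_zero_exactly_at:
  fixes p :: circle
  obtains \<psi> :: "circle \<Rightarrow> real"
  where "continuous_on UNIV \<psi>" "\<psi> p = 0" "\<And>c. c \<noteq> p \<Longrightarrow> \<psi> c > 0" "\<And>c. \<psi> c \<le> 2"
proof -
  obtain x0 where p: "p = circle_of x0"
    using circle_of_surj by blast
  define \<psi> where "\<psi> = (\<lambda>c. 1 - cos (2 * pi * (rep_circle c - x0)))"
  have psi: "\<psi> (circle_of x) = 1 - cos (2 * pi * (x - x0))" for x
  proof -
    have "circle_of (rep_circle (circle_of x)) = circle_of x"
      by (rule Quotient_abs_rep[OF Quotient_circle])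
    then obtain k where "rep_circle (circle_of x) - x = of_int k"
      unfolding circle_of_eq_iff by (rule Ints_cases)
    then have "2 * pi * (rep_circle (circle_of x) - x0) = 2 * pi * (x - x0) + 2 * pi * of_int k"
      by (simp add: algebra_simps)
    then show ?thesis
      by (simp add: \<psi>_def cos_add)
  qed
  show ?thesis
  proof
    show "continuous_on UNIV \<psi>"
      unfolding continuous_on_circle_iff psi by (intro continuous_intros)
    show "\<psi> p = 0"
      by (simp add: p psi)
    show "\<psi> c > 0" if "c \<noteq> p" for c
    proof -
      obtain x where c: "c = circle_of x"
        using circle_of_surj by blast
      have "cos (2 * pi * (x - x0)) \<noteq> 1"
      proof
        assume "cos (2 * pi * (x - x0)) = 1"
        then obtain k :: int where "2 * pi * (x - x0) = of_int k * 2 * pi"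
          by (auto simp: cos_one_2pi_int)
        then have "x - x0 = of_int k"
          by simp
        then show False
          using that by (simp add: c p circle_of_eq_iff)
      qed
      moreover have "cos (2 * pi * (x - x0)) \<le> 1"
        by (rule cos_le_one)
      ultimately show ?thesis
        unfolding c psi by linarith
    qed
    show "\<psi> c \<le> 2" for c
      using cos_ge_minus_one[of "2 * pi * (rep_circle c - x0)"] by (simp add: \<psi>_def)
  qed
qed

text \<open>
  The lifts of the fixed point are the integers, a countable set, so they cannot fill a
  neighbourhood of a maximum point.
\<close>

lemma near_max_off_fixed_point:
  fixes h :: "circle \<Rightarrow>\<^sub>C real"
  assumes "e > 0"
  obtains p where "p \<noteq> circle_of 0" "\<And>c. h c < h p + e"
proof -
  obtain a where a: "h a = (SUP x. h x)"
    using circle_fun_attains by metis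
  obtain x where x: "a = circle_of x"
    using circle_of_surj by blast
  define U where "U = {y. h a - e < h (circle_of y)}"
  have "continuous_on UNIV (\<lambda>y. h (circle_of y))"
    using apply_bcontfun[of h] unfolding bcontfun_circle_iff continuous_on_circle_iff .
  then have "open U"
    unfolding U_def by (intro open_Collect_less continuous_intros)
  moreover have "x \<in> U"
    using assms x by (simp add: U_def)
  moreover have "countable (\<int> :: real set)"
    by (simp add: Ints_def)
  ultimately obtain y where "y \<in> U" "y \<notin> \<int>"
    using open_minus_countable[of \<int> U] by blast
  show ?thesis
  proof
    show "circle_of y \<noteq> circle_of 0"
      using \<open>y \<notin> \<int>\<close> by (simp add: circle_of_eq_iff)
    show "h c < h (circle_of y) + e" for c
      using circle_fun_le_SUP[of h c] \<open>y \<in> U\<close> unfolding U_def a by simp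
  qed
qed

text \<open>
  A near-maximum point \<open>p\<close> becomes a maximum point of the truncation \<open>min (h c) (h p)\<close>, and the
  only one once a function vanishing just at \<open>p\<close> is subtracted. The truncation costs at most
  \<open>e / 4\<close> and the subtraction at most \<open>2 * (e / 8)\<close>.
\<close>

lemma unique_max_dense:
  fixes h :: "circle \<Rightarrow>\<^sub>C real"
  assumes "e > 0"
  obtains k p where "norm (k - h) < e" "p \<noteq> circle_of 0" "\<And>c. c \<noteq> p \<Longrightarrow> k c < k p"
proof -
  obtain p where p: "p \<noteq> circle_of 0" and near: "\<And>c. h c < h p + e / 4"
    using near_max_off_fixed_point[of "e / 4" h] assms by auto
  obtain \<psi> :: "circle \<Rightarrow> real" where cont: "continuous_on UNIV \<psi>" and zero: "\<psi> p = 0"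
    and pos: "\<And>c. c \<noteq> p \<Longrightarrow> \<psi> c > 0" and le2: "\<And>c. \<psi> c \<le> 2"
    using circle_fun_zero_exactly_at[of p] by metis
  define k where "k = Bcontfun (\<lambda>c. min (h c) (h p) - e / 8 * \<psi> c)"
  have "continuous_on UNIV (\<lambda>c. min (h c) (h p) - e / 8 * \<psi> c)"
    using apply_bcontfun[of h] cont
    by (intro continuous_intros) (simp_all add: bcontfun_circle_iff)
  then have k: "k c = min (h c) (h p) - e / 8 * \<psi> c" for c
    by (simp add: k_def Bcontfun_inverse bcontfun_circle_iff)
  have "norm (k - h) \<le> e / 2"
  proof (rule norm_bound)
    fix c
    have "0 \<le> \<psi> c"
      using zero pos by (cases "c = p") (auto intro: less_imp_le)
    then have "0 \<le> e / 8 * \<psi> c"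
      using assms by simp
    moreover have "e / 8 * \<psi> c \<le> e / 8 * 2"
      using assms le2 by (intro mult_left_mono) auto
    ultimately show "norm ((k - h) c) \<le> e / 2"
      using near[of c] by (auto simp: k min_def)
  qed
  then have "norm (k - h) < e"
    using assms by simp
  moreover have "k c < k p" if "c \<noteq> p" for c
  proof -
    have "0 < e / 8 * \<psi> c"
      using assms pos[OF that] by simp
    then show ?thesis
      by (simp add: k zero min_def)
  qed
  ultimately show ?thesis
    using p that by blast
qed

lemma norm_cls_le: "norm (cls f) \<le> norm f"
  using INF_norm_le[of f 0] by (simp add: norm_cont_mod_const.abs_eq)

text \<open>
  The two points \<open>tau 1 r\<close> and \<open>tau 2 r\<close> are preimages of \<open>r\<close> under the doubling map, so neither
  can be a maximum point: it would be \<open>p\<close>, and \<open>p\<close> would be fixed.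
\<close>

lemma unique_max_in_frak_A:
  assumes k: "F - G = cls k"
    and p: "p \<noteq> circle_of 0" and max: "\<And>c. c \<noteq> p \<Longrightarrow> k c < k p"
  shows "(F, G) \<in> frak_A"
proof -
  define h where "h = sup0_rep F - sup0_rep G"
  have "cls h = F - G"
    using cls_sup0_rep[of F] cls_sup0_rep[of G]
    by (simp add: h_def minus_cont_mod_const.abs_eq[symmetric])
  then obtain c where "h = k + const_bcontfun c"
    using k cls_eq_iff by metis
  then have hmax: "h y < h p" if "y \<noteq> p" for y
    using max[OF that] by simp
  have "h (circle_of r) \<noteq> h (circle_of (tau 1 r)) \<and> h (circle_of r) \<noteq> h (circle_of (tau 2 r))"
    if "norm (h + const_bcontfun (alpha h)) = h (circle_of r) + alpha h" for r
  proof -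
    have "h p \<le> h (circle_of r)"
      using norm_bounded[of "h + const_bcontfun (alpha h)" p] that by simp
    then have r: "circle_of r = p"
      using hmax[of "circle_of r"] by (meson not_le)
    have "{circle_of (tau 1 r), circle_of (tau 2 r)} \<subseteq> {c. doubling c = p}"
      using doubling_preimage[of r] r by (metis order_refl)
    moreover have "doubling p \<noteq> p"
      using p by (simp add: doubling_fixed_iff)
    ultimately have "circle_of (tau 1 r) \<noteq> p" "circle_of (tau 2 r) \<noteq> p"
      by auto
    then show ?thesis
      using hmax[of "circle_of (tau 1 r)"] hmax[of "circle_of (tau 2 r)"] r by simp
  qed
  then show ?thesis
    by (simp add: frak_A_def h_def Let_def)
qed

lemma frak_A_dense: "max_dist.mtopology closure_of frak_A = UNIV"
proof -
  have "\<exists>q\<in>frak_A. q \<in> max_dist.mball p e" if e: "e > 0" for p e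
  proof -
    obtain F G where p: "p = (F, G)"
      by (cases p)
    obtain h where h: "F - G = cls h"
      using cls_surj by blast
    obtain k c where k: "norm (k - h) < e" "c \<noteq> circle_of 0" "\<And>y. y \<noteq> c \<Longrightarrow> k y < k c"
      using unique_max_dense[OF e, of h] by metis
    have diff: "cls k = cls (k - h) + (F - G)"
      by (simp add: h plus_cont_mod_const.abs_eq)
    have "(F + cls (k - h), G) \<in> frak_A"
      by (rule unique_max_in_frak_A[OF _ k(2,3)]) (simp add: diff)
    moreover have "(F + cls (k - h), G) \<in> max_dist.mball p e"
      using norm_cls_le[of "k - h"] k(1) e
      unfolding p max_dist.in_mball by (simp add: max_dist_def)
    ultimately show ?thesis
      by blast
  qed
  then show ?thesis
    by (auto simp: max_dist.metric_closure_of)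
qed

text \<open>The shift by \<open>d\<close> cancels from the inequations.\<close>

lemma frak_A_alt:
  "frak_A =
    {(F, G). let f = sup0_rep F; g = sup0_rep G; d = alpha (f - g) in
      \<forall>x0\<in>{0..1}.
        norm (F - G) = norm (f - g + const_bcontfun d) \<and>
        norm (f - g + const_bcontfun d) = f (circle_of x0) - g (circle_of x0) + d \<longrightarrow>
          (\<forall>i\<in>{1, 2}. f (circle_of (tau i x0)) - g (circle_of (tau i x0)) + d \<noteq>
            f (circle_of x0) - g (circle_of x0) + d)}"
  by (auto simp: frak_A_def Let_def)

theorem corollary19:
  shows "max_dist.mtopology closure_of frak_A = UNIV \<and>
    max_dist.mtopology closure_of
      {(F, G). let f = sup0_rep F; g = sup0_rep G; d = alpha (f - g) in
        \<forall>x0\<in>{0..1}.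
          norm (F - G) = norm (f - g + const_bcontfun d) \<and>
          norm (f - g + const_bcontfun d) = f (circle_of x0) - g (circle_of x0) + d \<longrightarrow>
            (\<forall>i\<in>{1, 2}. f (circle_of (tau i x0)) - g (circle_of (tau i x0)) + d \<noteq>
              f (circle_of x0) - g (circle_of x0) + d)} = UNIV"
  using frak_A_dense unfolding frak_A_alt[symmetric] by blast

end
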